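(* Let $X$ be a Banach space of analytic functions on $\mathbb{D}$ and let $T\in\mathcal{L}(H(\mathbb{D}))$ be an isomorphism of $H(\mathbb{D})$ (onto itself) satisfying $T(X)\subseteq X$. Then $([T,X],\|\cdot\|_{[T,X]})$ is a Banach space.
   Context: $\mathbb{D}$ is the open unit disc in $\mathbb{C}$; $H(\mathbb{D})$ is the Fréchet space of all analytic functions on $\mathbb{D}$ with the topology of uniform convergence on compact subsets of $\mathbb{D}$; $\mathcal{L}(E)$ denotes the space of continuous linear operators from $E$ into itself. A Banach space of analytic functions on $\mathbb{D}$ is a vector subspace $X\subseteq H(\mathbb{D})$ which is a Banach space for a norm $\|\cdot\|_X$ and such that the natural inclusion $X\to H(\mathbb{D})$ is continuous. For $T\in\mathcal{L}(H(\mathbb{D}))$ with $T(X)\subseteq X$, the optimal domain is $[T,X]:=\{f\in H(\mathbb{D}): Tf\in X\}$, endowed with the semi-norm $\|f\|_{[T,X]}:=\|Tf\|_X$. *)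

theory Defs
  imports "HOL-Analysis.Analysis"
begin

section \<open>The space of holomorphic functions on the unit disc\<close>

text \<open>
  HOL functions are total, so an analytic function on the open unit disc is represented by its
  extension by \<open>0\<close>; the values outside the disc carry no information.
\<close>

typedef hol_disc =
  "{f :: complex \<Rightarrow> complex. f holomorphic_on ball 0 1 \<and> (\<forall>z. z \<notin> ball 0 1 \<longrightarrow> f z = 0)}"
  morphisms hd_app Abs_hol_disc
  by (rule exI [of _ "\<lambda>_. 0"]) auto

setup_lifting type_definition_hol_disc

lemma hd_app_holomorphic: "hd_app f holomorphic_on ball 0 1"
  using hd_app [of f] by simp

lemma hd_app_outside: "z \<notin> ball 0 1 \<Longrightarrow> hd_app f z = 0"
  using hd_app [of f] by simp

lemma hol_disc_eqI:
  assumes "\<And>z. z \<in> ball 0 1 \<Longrightarrow> hd_app f z = hd_app g z"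
  shows "f = g"
proof -
  have "hd_app f z = hd_app g z" for z
    by (cases "z \<in> ball 0 1") (simp_all only: assms hd_app_outside not_False_eq_True)
  then have "hd_app f = hd_app g" by (rule ext)
  then show ?thesis by (simp only: hd_app_inject)
qed

instantiation hol_disc :: ab_group_add
begin

lift_definition zero_hol_disc :: hol_disc is "\<lambda>_. 0"
  by simp

lift_definition plus_hol_disc :: "hol_disc \<Rightarrow> hol_disc \<Rightarrow> hol_disc" is "\<lambda>f g z. f z + g z"
  by (simp add: holomorphic_on_add)

lift_definition minus_hol_disc :: "hol_disc \<Rightarrow> hol_disc \<Rightarrow> hol_disc" is "\<lambda>f g z. f z - g z"
  by (simp add: holomorphic_on_diff)

lift_definition uminus_hol_disc :: "hol_disc \<Rightarrow> hol_disc" is "\<lambda>f z. - f z"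
  by (simp add: holomorphic_on_minus)

instance
proof
  fix f g h :: hol_disc
  show "f + g + h = f + (g + h)"
    by (rule hol_disc_eqI) (simp add: plus_hol_disc.rep_eq add.assoc)
  show "f + g = g + f"
    by (rule hol_disc_eqI) (simp add: plus_hol_disc.rep_eq add.commute)
  show "0 + f = f"
    by (rule hol_disc_eqI) (simp add: plus_hol_disc.rep_eq zero_hol_disc.rep_eq)
  show "- f + f = 0"
    by (rule hol_disc_eqI)
      (simp add: plus_hol_disc.rep_eq zero_hol_disc.rep_eq uminus_hol_disc.rep_eq)
  show "f - g = f + - g"
    by (rule hol_disc_eqI)
      (simp add: plus_hol_disc.rep_eq minus_hol_disc.rep_eq uminus_hol_disc.rep_eq)
qed

end

lift_definition hd_scale :: "complex \<Rightarrow> hol_disc \<Rightarrow> hol_disc" is "\<lambda>c f z. c * f z"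
  by (simp add: holomorphic_on_mult)

interpretation HD: vector_space hd_scale
proof
  fix a b :: complex and f g :: hol_disc
  show "hd_scale a (f + g) = hd_scale a f + hd_scale a g"
    by (rule hol_disc_eqI) (simp add: hd_scale.rep_eq plus_hol_disc.rep_eq distrib_left)
  show "hd_scale (a + b) f = hd_scale a f + hd_scale b f"
    by (rule hol_disc_eqI) (simp add: hd_scale.rep_eq plus_hol_disc.rep_eq distrib_right)
  show "hd_scale a (hd_scale b f) = hd_scale (a * b) f"
    by (rule hol_disc_eqI) (simp add: hd_scale.rep_eq)
  show "hd_scale 1 f = f"
    by (rule hol_disc_eqI) (simp add: hd_scale.rep_eq)
qed

text \<open>The topology of uniform convergence on compact subsets of the disc.\<close>

definition hd_nbhd :: "complex set \<Rightarrow> real \<Rightarrow> hol_disc \<Rightarrow> hol_disc set" where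
  "hd_nbhd K e f = {g. \<forall>z\<in>K. cmod (hd_app g z - hd_app f z) < e}"

lemma hd_nbhd_mono: "K' \<subseteq> K \<Longrightarrow> e \<le> e' \<Longrightarrow> hd_nbhd K e f \<subseteq> hd_nbhd K' e' f"
  by (force simp: hd_nbhd_def)

instantiation hol_disc :: topological_space
begin

definition open_hol_disc :: "hol_disc set \<Rightarrow> bool" where
  "open_hol_disc U \<longleftrightarrow>
     (\<forall>f\<in>U. \<exists>K e. compact K \<and> K \<subseteq> ball 0 1 \<and> 0 < e \<and> hd_nbhd K e f \<subseteq> U)"

instance
proof
  show "open (UNIV :: hol_disc set)"
    unfolding open_hol_disc_def by (intro ballI exI [of _ "{}"] exI [of _ "1::real"]) simp
next
  fix S T :: "hol_disc set"
  assume S: "open S" and T: "open T"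
  show "open (S \<inter> T)"
    unfolding open_hol_disc_def
  proof
    fix f assume f: "f \<in> S \<inter> T"
    obtain K e where K: "compact K" "K \<subseteq> ball 0 1" "0 < e" "hd_nbhd K e f \<subseteq> S"
      using S f unfolding open_hol_disc_def by auto
    obtain L d where L: "compact L" "L \<subseteq> ball 0 1" "0 < d" "hd_nbhd L d f \<subseteq> T"
      using T f unfolding open_hol_disc_def by auto
    have "hd_nbhd (K \<union> L) (min e d) f \<subseteq> S \<inter> T"
      using hd_nbhd_mono [of K "K \<union> L" "min e d" e f] hd_nbhd_mono [of L "K \<union> L" "min e d" d f]
        K(4) L(4) by auto
    then show "\<exists>K e. compact K \<and> K \<subseteq> ball 0 1 \<and> 0 < e \<and> hd_nbhd K e f \<subseteq> S \<inter> T"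
      using K L by (intro exI [of _ "K \<union> L"] exI [of _ "min e d"]) auto
  qed
next
  fix \<K> :: "hol_disc set set"
  assume "\<forall>S\<in>\<K>. open S"
  then show "open (\<Union>\<K>)"
    unfolding open_hol_disc_def by (meson Sup_upper UnionE subset_trans)
qed

end

lemma open_hd_nbhd_interior:
  assumes "compact K" "K \<subseteq> ball 0 1" "0 < e"
  shows "\<exists>U. open U \<and> f \<in> U \<and> U \<subseteq> hd_nbhd K e f"
proof (intro exI conjI)
  let ?U = "{g. \<exists>d>0. hd_nbhd K d g \<subseteq> hd_nbhd K e f}"
  show "open ?U"
    unfolding open_hol_disc_def
  proof
    fix g assume "g \<in> ?U"
    then obtain d where d: "d > 0" "hd_nbhd K d g \<subseteq> hd_nbhd K e f" by auto
    have "h \<in> ?U" if h: "h \<in> hd_nbhd K (d/2) g" for h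
    proof -
      have "k \<in> hd_nbhd K d g" if k: "k \<in> hd_nbhd K (d/2) h" for k
        unfolding hd_nbhd_def
      proof (clarify)
        fix z assume z: "z \<in> K"
        have "cmod (hd_app k z - hd_app h z) < d/2" "cmod (hd_app h z - hd_app g z) < d/2"
          using h k z by (auto simp: hd_nbhd_def)
        then show "cmod (hd_app k z - hd_app g z) < d"
          by (rule norm_diff_triangle_less [THEN less_le_trans]) simp
      qed
      then have "hd_nbhd K (d/2) h \<subseteq> hd_nbhd K e f" using d by blast
      then show ?thesis using d by (auto intro!: exI [of _ "d/2"])
    qed
    then show "\<exists>K e. compact K \<and> K \<subseteq> ball 0 1 \<and> 0 < e \<and> hd_nbhd K e g \<subseteq> ?U"
      using assms d by (intro exI [of _ K] exI [of _ "d/2"]) auto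
  qed
  show "f \<in> ?U" using assms by auto
  show "?U \<subseteq> hd_nbhd K e f" by (fastforce simp: hd_nbhd_def)
qed

lemma tendsto_hol_disc_iff:
  "(u \<longlongrightarrow> f) F \<longleftrightarrow>
     (\<forall>K. compact K \<and> K \<subseteq> ball 0 1 \<longrightarrow> uniform_limit K (\<lambda>n. hd_app (u n)) (hd_app f) F)"
proof (intro iffI allI impI)
  fix K :: "complex set"
  assume u: "(u \<longlongrightarrow> f) F" 
    and K: "compact K \<and> K \<subseteq> ball 0 1"
  show "uniform_limit K (\<lambda>n. hd_app (u n)) (hd_app f) F"
  proof (rule uniform_limitI)
    fix e :: real assume "0 < e"
    then obtain U where U: "open U" "f \<in> U" "U \<subseteq> hd_nbhd K e f"
      using open_hd_nbhd_interior K by metis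
    have "\<forall>\<^sub>F n in F. u n \<in> U" using u U by (simp add: topological_tendstoD)
    then show "\<forall>\<^sub>F n in F. \<forall>z\<in>K. dist (hd_app (u n) z) (hd_app f z) < e"
      by (rule eventually_mono) (use U in \<open>auto simp: hd_nbhd_def dist_norm\<close>)
  qed
next
  assume u: "\<forall>K. compact K \<and> K \<subseteq> ball 0 1 \<longrightarrow> uniform_limit K (\<lambda>n. hd_app (u n)) (hd_app f) F"
  show "(u \<longlongrightarrow> f) F"
  proof (rule topological_tendstoI)
    fix U assume "open U" "f \<in> U"
    then obtain K e where K: "compact K" "K \<subseteq> ball 0 1" "0 < e" "hd_nbhd K e f \<subseteq> U"
      unfolding open_hol_disc_def by metis
    then have "\<forall>\<^sub>F n in F. \<forall>z\<in>K. dist (hd_app (u n) z) (hd_app f z) < e"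
      using u by (auto intro: uniform_limitD)
    then show "\<forall>\<^sub>F n in F. u n \<in> U"
      by (rule eventually_mono) (use K in \<open>auto simp: hd_nbhd_def dist_norm\<close>)
  qed
qed

section \<open>Banach spaces carried by linear subspaces\<close>

definition norm_on :: "hol_disc set \<Rightarrow> (hol_disc \<Rightarrow> real) \<Rightarrow> bool" where
  "norm_on V N \<longleftrightarrow>
     (\<forall>f\<in>V. 0 \<le> N f) \<and>
     (\<forall>f\<in>V. N f = 0 \<longleftrightarrow> f = 0) \<and>
     (\<forall>f\<in>V. \<forall>c. N (hd_scale c f) = cmod c * N f) \<and>
     (\<forall>f\<in>V. \<forall>g\<in>V. N (f + g) \<le> N f + N g)"

text \<open>
  The locale \<open>Metric_space\<close> requires nonnegativity and symmetry of the distance also outside the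
  carrier, where \<open>N\<close> is arbitrary; hence the case distinction.
\<close>

definition norm_dist :: "hol_disc set \<Rightarrow> (hol_disc \<Rightarrow> real) \<Rightarrow> hol_disc \<Rightarrow> hol_disc \<Rightarrow> real" where
  "norm_dist V N f g = (if f \<in> V \<and> g \<in> V then N (f - g) else 0)"

lemma Metric_space_norm_dist:
  assumes V: "HD.subspace V" and N: "norm_on V N"
  shows "Metric_space V (norm_dist V N)"
proof
  have diff: "f - g \<in> V" if "f \<in> V" "g \<in> V" for f g
    using V that by (rule HD.subspace_diff)
  have hom: "N (hd_scale c f) = cmod c * N f" if "f \<in> V" for c f
    using N that by (simp add: norm_on_def)
  have tri: "N (f + g) \<le> N f + N g" if "f \<in> V" "g \<in> V" for f g
    using N that by (simp add: norm_on_def)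
  show "0 \<le> norm_dist V N f g" for f g
    using N diff by (simp add: norm_dist_def norm_on_def)
  show "norm_dist V N f g = norm_dist V N g f" for f g
  proof (cases "f \<in> V \<and> g \<in> V")
    case True
    have "N (hd_scale (-1) (f - g)) = cmod (-1) * N (f - g)"
      using diff True by (intro hom) auto
    moreover have "hd_scale (-1) (f - g) = g - f"
      by (simp add: HD.scale_minus_left [of 1])
    ultimately have "N (g - f) = N (f - g)" by simp
    then show ?thesis using True by (simp add: norm_dist_def)
  qed (auto simp: norm_dist_def)
  show "norm_dist V N f g = 0 \<longleftrightarrow> f = g" if "f \<in> V" "g \<in> V" for f g
    using N diff that by (simp add: norm_dist_def norm_on_def)
  show "norm_dist V N f h \<le> norm_dist V N f g + norm_dist V N g h"
    if "f \<in> V" "g \<in> V" "h \<in> V" for f g h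
  proof -
    have "N ((f - g) + (g - h)) \<le> N (f - g) + N (g - h)"
      using diff that by (intro tri)
    then show ?thesis using that by (simp add: norm_dist_def)
  qed
qed

definition banach_space_on :: "hol_disc set \<Rightarrow> (hol_disc \<Rightarrow> real) \<Rightarrow> bool" where
  "banach_space_on V N \<longleftrightarrow>
     HD.subspace V \<and> norm_on V N \<and> Metric_space.mcomplete V (norm_dist V N)"

definition banach_space_of_analytic_functions ::
  "hol_disc set \<Rightarrow> (hol_disc \<Rightarrow> real) \<Rightarrow> bool" where
  "banach_space_of_analytic_functions X N \<longleftrightarrow>
     banach_space_on X N \<and>
     continuous_map (Metric_space.mtopology X (norm_dist X N)) euclidean (\<lambda>f. f)"

section \<open>Operators and optimal domains\<close>

definition continuous_linear_op :: "(hol_disc \<Rightarrow> hol_disc) \<Rightarrow> bool" where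
  "continuous_linear_op T \<longleftrightarrow> Vector_Spaces.linear hd_scale hd_scale T \<and> continuous_on UNIV T"

definition isomorphism_op :: "(hol_disc \<Rightarrow> hol_disc) \<Rightarrow> bool" where
  "isomorphism_op T \<longleftrightarrow> continuous_linear_op T \<and>
     (\<exists>S. continuous_linear_op S \<and> S \<circ> T = id \<and> T \<circ> S = id)"

definition optimal_domain :: "(hol_disc \<Rightarrow> hol_disc) \<Rightarrow> hol_disc set \<Rightarrow> hol_disc set" where
  "optimal_domain T X = {f. T f \<in> X}"

definition optimal_seminorm ::
  "(hol_disc \<Rightarrow> hol_disc) \<Rightarrow> (hol_disc \<Rightarrow> real) \<Rightarrow> hol_disc \<Rightarrow> real" where
  "optimal_seminorm T N f = N (T f)"

end

theory Submission
  imports Defs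
begin

text \<open>The optimal domain is the preimage of \<open>X\<close> under \<open>T\<close>, normed by
  \<open>N \<circ> T\<close>. Since \<open>T\<close> is a linear bijection of the whole space, it
  restricts to a linear isometry of this preimage onto \<open>X\<close>, and the Banach space
  structure is pulled back along it. Injectivity makes the semi-norm a norm
  (\<open>norm_on_pullback\<close>); surjectivity lets limits found in \<open>X\<close> be carried
  back, which gives completeness (\<open>mcomplete_isometric_preimage\<close>).\<close>

lemma norm_on_pullback:
  assumes N: "norm_on V N" and lin: "Vector_Spaces.linear hd_scale hd_scale T" and inj: "inj T"
  shows "norm_on (T -` V) (N \<circ> T)"
proof -
  interpret T: Vector_Spaces.linear hd_scale hd_scale T by (fact lin)
  have "T f = 0 \<longleftrightarrow> f = 0" for f
    using inj T.zero by (metis injD)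
  then show ?thesis
    using N by (simp add: norm_on_def T.add T.scale)
qed

text \<open>The image of a Cauchy sequence is Cauchy, hence converges; the preimage of its limit is
  the limit of the original sequence, because distances agree.\<close>

lemma mcomplete_isometric_preimage:
  assumes M: "Metric_space M d" "Metric_space M' d'"
    and T: "bij_betw T M M'"
    and iso: "\<And>x y. \<lbrakk>x \<in> M; y \<in> M\<rbrakk> \<Longrightarrow> d x y = d' (T x) (T y)"
    and complete: "Metric_space.mcomplete M' d'"
  shows "Metric_space.mcomplete M d"
proof -
  interpret M: Metric_space M d by (fact M)
  interpret M': Metric_space M' d' by (fact M)
  have TM: "T x \<in> M'" if "x \<in> M" for x
    using T that by (rule bij_betwE [THEN bspec])
  have "\<exists>x. limitin M.mtopology s x sequentially" if s: "M.MCauchy s" for s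
  proof -
    have sM: "s n \<in> M" for n
      using s by (auto simp: M.MCauchy_def)
    then have "M'.MCauchy (T \<circ> s)"
      using s TM unfolding M.MCauchy_def M'.MCauchy_def by (auto simp: iso)
    then obtain y where y: "limitin M'.mtopology (T \<circ> s) y sequentially"
      using complete unfolding M'.mcomplete_def by blast
    \<comment> \<open>Convergence in \<open>M'.mtopology\<close> includes membership of the limit in
      the carrier, so \<open>y\<close> has a preimage in \<open>M\<close>.\<close>
    then have "y \<in> M'"
      by (simp add: M'.limit_metric_sequentially)
    then obtain x where x: "x \<in> M" "T x = y"
      using T by (auto simp: bij_betw_def)
    have "limitin M.mtopology s x sequentially"
      using y x sM
      by (fastforce simp: M.limit_metric_sequentially M'.limit_metric_sequentially iso)
    then show ?thesis ..
  qed
  then show ?thesis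
    by (simp add: M.mcomplete_def)
qed

lemma banach_space_on_pullback:
  assumes V: "banach_space_on V N"
    and lin: "Vector_Spaces.linear hd_scale hd_scale T" and bij: "bij T"
  shows "banach_space_on (T -` V) (N \<circ> T)"
proof -
  interpret T: Vector_Spaces.linear hd_scale hd_scale T by (fact lin)
  have sub: "HD.subspace V" and N: "norm_on V N"
    and complete: "Metric_space.mcomplete V (norm_dist V N)"
    using V by (auto simp: banach_space_on_def)
  have sub': "HD.subspace (T -` V)"
    using sub by (rule T.subspace_vimage)
  have N': "norm_on (T -` V) (N \<circ> T)"
    using N lin bij_is_inj [OF bij] by (rule norm_on_pullback)
  \<comment> \<open>Surjectivity of \<open>T\<close> ensures that the preimage of \<open>V\<close>
    is mapped onto all of \<open>V\<close>.\<close>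
  have "bij_betw T (T -` V) V"
    using bij by (auto simp: bij_betw_def inj_on_def surj_image_vimage_eq)
  \<comment> \<open>\<open>T\<close> is an isometry for the two distances because
    \<open>T (f - g) = T f - T g\<close>.\<close>
  then have "Metric_space.mcomplete (T -` V) (norm_dist (T -` V) (N \<circ> T))"
    using Metric_space_norm_dist [OF sub' N'] Metric_space_norm_dist [OF sub N] complete
    by (elim mcomplete_isometric_preimage) (auto simp: norm_dist_def T.diff)
  with sub' N' show ?thesis
    by (simp add: banach_space_on_def)
qed

theorem proposition2p6:
  fixes X :: "hol_disc set" and N :: "hol_disc \<Rightarrow> real" and T :: "hol_disc \<Rightarrow> hol_disc"
  assumes "banach_space_of_analytic_functions X N"
    and "continuous_linear_op T"
    and "isomorphism_op T"
    and "T ` X \<subseteq> X"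
  shows "banach_space_on (optimal_domain T X) (optimal_seminorm T N)"
proof -
  have "bij T"
    using assms(3) o_bij unfolding isomorphism_op_def by blast
  then have "banach_space_on (T -` X) (N \<circ> T)"
    using assms(1,2)
    by (intro banach_space_on_pullback)
      (auto simp: banach_space_of_analytic_functions_def continuous_linear_op_def)
  moreover have "optimal_domain T X = T -` X" "optimal_seminorm T N = N \<circ> T"
    by (auto simp: optimal_domain_def optimal_seminorm_def)
  ultimately show ?thesis by simp
qed

end
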